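(* Let $n\ge 2$ and let $K_n^*$ be the complete graph $K_n$ rooted at a vertex $r$, whose automorphism group is $E_1\times S_{n-1}$ (all permutations of the vertices fixing $r$). For a divisor $d$ of $n-1$, the number $i_d$ of unlabeled imbeddings of $K_n^*$ that are $d$-fold symmetric, i.e. whose map-automorphism group is cyclic of order $d$ (the group $E_1\times C_d[E_{(n-1)/d}]$: fixing $r$ and generated by a permutation whose cycles on the other $n-1$ vertices all have length $d$), is \[ i_d=d\sum_{k:\ d\mid k,\ k\mid n-1}\mu(k/d)\,\frac{((n-2)!)^{(n-1)/k}}{n-1},\] where $\mu$ is the Möbius function.
   Context: A rotation at a vertex $v$ is a cyclic permutation of its neighborhood $N(v)$ (a single cycle through all of $N(v)$); a map is $M=(K_n,\rho)$ with $\rho=\{\rho_v\}$ a rotation system (maps correspond to labeled 2-cell imbeddings in oriented surfaces). The group $E_1\times S_{n-1}$ acts on maps by $\rho\mapsto\rho'$ with $\rho'_{\gamma(v)}=\gamma\rho_v\gamma^{-1}$; the stabilizer of $M$ in this group is its map-automorphism group, and the orbits of maps are the unlabeled imbeddings of $K_n^*$. *)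

theory Defs
  imports
    Complex_Main
    "HOL-Algebra.Sym_Groups"
    "HOL-Algebra.Group_Action"
    "HOL-Combinatorics.Orbits"
    "HOL-Computational_Algebra.Squarefree"
begin

definition moebius_mu :: "nat \<Rightarrow> int" where
  "moebius_mu n = (if squarefree n then (-1) ^ card (prime_factors n) else 0)"

definition complete_edges :: "'a set \<Rightarrow> 'a set set" where
  "complete_edges V = {{u, v} |u v. u \<in> V \<and> v \<in> V \<and> u \<noteq> v}"

definition neighborhood :: "'a set set \<Rightarrow> 'a \<Rightarrow> 'a set" where
  "neighborhood E v = {u. {u, v} \<in> E}"

definition rooted_aut_group :: "'a set \<Rightarrow> 'a set set \<Rightarrow> 'a \<Rightarrow> ('a \<Rightarrow> 'a) monoid" where
  "rooted_aut_group V E r =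
     \<lparr>carrier = {\<gamma>. \<gamma> permutes V \<and> (`) \<gamma> ` E = E \<and> \<gamma> r = r}, mult = (\<circ>), one = id\<rparr>"

text \<open>
  A one-element set carries exactly one rotation, the identity, since
  \<^term>\<open>cyclic_on id {x}\<close> holds.
\<close>

definition is_rotation :: "'a set \<Rightarrow> ('a \<Rightarrow> 'a) \<Rightarrow> bool" where
  "is_rotation N \<pi> \<longleftrightarrow> \<pi> permutes N \<and> cyclic_on \<pi> N"

definition rotation_systems :: "'a set \<Rightarrow> 'a set set \<Rightarrow> ('a \<Rightarrow> 'a \<Rightarrow> 'a) set" where
  "rotation_systems V E = (\<Pi>\<^sub>E v\<in>V. {\<pi>. is_rotation (neighborhood E v) \<pi>})"

definition map_action ::
    "'a set \<Rightarrow> 'a set set \<Rightarrow> ('a \<Rightarrow> 'a) \<Rightarrow> ('a \<Rightarrow> 'a \<Rightarrow> 'a) \<Rightarrow> 'a \<Rightarrow> 'a \<Rightarrow> 'a" where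
  "map_action V E \<gamma> =
     (\<lambda>\<rho>\<in>rotation_systems V E. \<lambda>u\<in>V. \<gamma> \<circ> \<rho> (inv' \<gamma> u) \<circ> inv' \<gamma>)"

definition map_aut_group ::
    "'a set \<Rightarrow> 'a set set \<Rightarrow> 'a \<Rightarrow> ('a \<Rightarrow> 'a \<Rightarrow> 'a) \<Rightarrow> ('a \<Rightarrow> 'a) set" where
  "map_aut_group V E r \<rho> = stabilizer (rooted_aut_group V E r) (map_action V E) \<rho>"

definition unlabeled_imbeddings :: "'a set \<Rightarrow> 'a set set \<Rightarrow> 'a \<Rightarrow> ('a \<Rightarrow> 'a \<Rightarrow> 'a) set set" where
  "unlabeled_imbeddings V E r = orbits (rooted_aut_group V E r) (rotation_systems V E) (map_action V E)"

definition d_fold_symmetric ::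
    "'a set \<Rightarrow> 'a set set \<Rightarrow> 'a \<Rightarrow> nat \<Rightarrow> ('a \<Rightarrow> 'a \<Rightarrow> 'a) \<Rightarrow> bool" where
  "d_fold_symmetric V E r d \<rho> \<longleftrightarrow>
     card (map_aut_group V E r \<rho>) = d \<and>
     (\<exists>\<gamma>\<in>carrier (rooted_aut_group V E r).
        map_aut_group V E r \<rho> = generate (rooted_aut_group V E r) {\<gamma>} \<and>
        (\<forall>v\<in>V - {r}. card (Orbits.orbit \<gamma> v) = d))"

text \<open>
  Maps in one orbit have conjugate automorphism groups, so the quantifier over the
  representatives \<open>\<rho>\<close> of the (nonempty) orbit could equivalently be existential.
\<close>

definition symmetric_imbedding_count :: "'a set \<Rightarrow> 'a \<Rightarrow> nat \<Rightarrow> nat" where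
  "symmetric_imbedding_count V r d =
     card {X \<in> unlabeled_imbeddings V (complete_edges V) r.
             \<forall>\<rho>\<in>X. d_fold_symmetric V (complete_edges V) r d \<rho>}"

lemma neighborhood_complete:
  "v \<in> V \<Longrightarrow> neighborhood (complete_edges V) v = V - {v}"
  by (auto simp: neighborhood_def complete_edges_def doubleton_eq_iff)

lemma permutes_image_complete_edges:
  assumes "\<gamma> permutes V"
  shows "(`) \<gamma> ` complete_edges V = complete_edges V"
proof -
  have sub: "(`) p ` complete_edges V \<subseteq> complete_edges V" if "p permutes V" for p
  proof
    fix e assume "e \<in> (`) p ` complete_edges V"
    then obtain u v where "e = {p u, p v}" "u \<in> V" "v \<in> V" "u \<noteq> v"
      by (auto simp: complete_edges_def)
    moreover have "p u \<noteq> p v" "p u \<in> V" "p v \<in> V"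
      using that calculation by (auto simp: permutes_in_image dest: permutes_inj injD)
    ultimately show "e \<in> complete_edges V"
      unfolding complete_edges_def by blast
  qed
  have "complete_edges V = (`) \<gamma> ` (`) (inv' \<gamma>) ` complete_edges V"
    by (simp add: image_image permutes_inverses[OF assms])
  also have "\<dots> \<subseteq> (`) \<gamma> ` complete_edges V"
    using sub[OF permutes_inv[OF assms]] by (rule image_mono)
  finally show ?thesis using sub[OF assms] by blast
qed

lemma carrier_rooted_aut_group_complete:
  "carrier (rooted_aut_group V (complete_edges V) r) = {\<gamma>. \<gamma> permutes V \<and> \<gamma> r = r}"
  using permutes_image_complete_edges[of _ V] by (auto simp only: rooted_aut_group_def partial_object.select_convs)

lemma group_rooted_aut_group: "group (rooted_aut_group V E r)"
proof (rule groupI)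
  fix x assume x: "x \<in> carrier (rooted_aut_group V E r)"
  then have p: "x permutes V" and e: "(`) x ` E = E" and r: "x r = r"
    by (auto simp: rooted_aut_group_def)
  have "(`) (inv' x) ` E = (`) (inv' x) ` (`) x ` E" using e by simp
  also have "\<dots> = E" by (simp add: image_image permutes_inverses[OF p])
  finally have "(`) (inv' x) ` E = E" .
  then have "inv' x \<in> carrier (rooted_aut_group V E r)"
    using p r by (simp add: rooted_aut_group_def permutes_inv permutes_inverses permutes_inv_eq)
  then show "\<exists>y\<in>carrier (rooted_aut_group V E r).
      y \<otimes>\<^bsub>rooted_aut_group V E r\<^esub> x = \<one>\<^bsub>rooted_aut_group V E r\<^esub>"
    by (rule bexI[rotated]) (simp add: rooted_aut_group_def permutes_inv_o[OF p])
next
  fix x y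
  assume xy: "x \<in> carrier (rooted_aut_group V E r)" "y \<in> carrier (rooted_aut_group V E r)"
  have "(`) (x \<circ> y) ` E = (`) x ` (`) y ` E" by (simp add: image_image comp_def)
  with xy show "x \<otimes>\<^bsub>rooted_aut_group V E r\<^esub> y \<in> carrier (rooted_aut_group V E r)"
    by (simp add: rooted_aut_group_def permutes_compose)
qed (auto simp: rooted_aut_group_def permutes_id comp_assoc)

lemma map_action_apply:
  assumes "\<gamma> \<in> carrier (rooted_aut_group V E r)" "\<rho> \<in> rotation_systems V E" "v \<in> V"
  shows "map_action V E \<gamma> \<rho> (\<gamma> v) = \<gamma> \<circ> \<rho> v \<circ> inv' \<gamma>"
  using assms by (auto simp: rooted_aut_group_def map_action_def permutes_in_image permutes_inverses)

lemma map_action_closed: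
  assumes \<gamma>: "\<gamma> \<in> carrier (rooted_aut_group V E r)" and \<rho>: "\<rho> \<in> rotation_systems V E"
  shows "map_action V E \<gamma> \<rho> \<in> rotation_systems V E"
proof -
  have p: "\<gamma> permutes V" and e: "(`) \<gamma> ` E = E"
    using \<gamma> by (auto simp: rooted_aut_group_def)
  have inv_edge: "{inv' \<gamma> a, inv' \<gamma> b} \<in> E" if "{a, b} \<in> E" for a b
  proof -
    have "{a, b} \<in> (`) \<gamma> ` E" using that by (simp only: e)
    then obtain f where "f \<in> E" and f: "{a, b} = \<gamma> ` f" by (rule imageE)
    have "inv' \<gamma> ` {a, b} = f"
      unfolding f by (simp add: image_image permutes_inverses[OF p])
    then show ?thesis using \<open>f \<in> E\<close> by simp
  qed
  have edge: "{\<gamma> a, \<gamma> b} \<in> E" if "{a, b} \<in> E" for a b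
    using imageI[OF that, of "(`) \<gamma>"] unfolding e by simp
  have "is_rotation (neighborhood E u) (\<gamma> \<circ> \<rho> (inv' \<gamma> u) \<circ> inv' \<gamma>)" if u: "u \<in> V" for u
  proof -
    let ?w = "inv' \<gamma> u"
    let ?g = "\<gamma> \<circ> \<rho> ?w \<circ> inv' \<gamma>"
    have "?w \<in> V" using u p by (simp add: permutes_inv permutes_in_image)
    then have rot: "\<rho> ?w permutes neighborhood E ?w" "cyclic_on (\<rho> ?w) (neighborhood E ?w)"
      using \<rho> by (auto simp: rotation_systems_def is_rotation_def PiE_def Pi_def)
    have nb: "\<gamma> ` neighborhood E ?w = neighborhood E u"
    proof (intro equalityI subsetI)
      fix x assume "x \<in> \<gamma> ` neighborhood E ?w"
      then show "x \<in> neighborhood E u"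
        using edge[of _ ?w] by (auto simp: neighborhood_def permutes_inverses[OF p])
    next
      fix x assume "x \<in> neighborhood E u"
      then have "inv' \<gamma> x \<in> neighborhood E ?w" by (simp add: neighborhood_def inv_edge)
      then show "x \<in> \<gamma> ` neighborhood E ?w"
        by (metis imageI permutes_inverses(1)[OF p])
    qed
    have "bij ?g"
      using p rot(1) by (intro bij_comp permutes_bij[OF permutes_inv[OF p]] permutes_bij)
    moreover have "?g x = x" if "x \<notin> neighborhood E u" for x
    proof -
      have "inv' \<gamma> x \<notin> neighborhood E ?w"
        using that nb by (metis imageI permutes_inverses(1)[OF p])
      then show ?thesis
        using rot(1) by (simp add: permutes_not_in permutes_inverses[OF p])
    qed
    ultimately have "?g permutes neighborhood E u"
      unfolding permutes_def bij_iff by blast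
    moreover have "cyclic_on ?g (neighborhood E u)"
      using cyclic_on_image[OF rot(2), of ?g \<gamma>] by (simp add: nb permutes_inverses[OF p])
    ultimately show ?thesis by (simp add: is_rotation_def)
  qed
  then show ?thesis using \<rho> by (simp add: map_action_def rotation_systems_def)
qed

lemma map_action_compose:
  assumes a: "\<alpha> \<in> carrier (rooted_aut_group V E r)" and b: "\<beta> \<in> carrier (rooted_aut_group V E r)"
    and \<rho>: "\<rho> \<in> rotation_systems V E"
  shows "map_action V E (\<alpha> \<circ> \<beta>) \<rho> = map_action V E \<alpha> (map_action V E \<beta> \<rho>)"
proof
  fix u
  have p: "\<alpha> permutes V" "\<beta> permutes V" using a b by (auto simp: rooted_aut_group_def)
  have "inv' (\<alpha> \<circ> \<beta>) = inv' \<beta> \<circ> inv' \<alpha>"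
    using p by (simp add: o_inv_distrib permutes_bij)
  moreover have "inv' \<alpha> u \<in> V" if "u \<in> V"
    using that p by (simp add: permutes_inv permutes_in_image)
  ultimately show "map_action V E (\<alpha> \<circ> \<beta>) \<rho> u = map_action V E \<alpha> (map_action V E \<beta> \<rho>) u"
    using map_action_closed[OF b \<rho>] \<rho> by (simp add: map_action_def comp_assoc)
qed

lemma map_action_id:
  assumes "\<rho> \<in> rotation_systems V E"
  shows "map_action V E id \<rho> = \<rho>"
  using assms by (auto simp: map_action_def rotation_systems_def PiE_def extensional_def restrict_def)

lemma group_action_map_action:
  "group_action (rooted_aut_group V E r) (rotation_systems V E) (map_action V E)"
proof -
  let ?G = "rooted_aut_group V E r" and ?R = "rotation_systems V E"
  interpret group ?G by (rule group_rooted_aut_group)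
  have one: "\<one>\<^bsub>?G\<^esub> = id" and mult: "\<And>x y. x \<otimes>\<^bsub>?G\<^esub> y = x \<circ> y"
    by (simp_all add: rooted_aut_group_def)
  have cancel: "map_action V E (inv\<^bsub>?G\<^esub> g) (map_action V E g \<rho>) = \<rho>"
      "map_action V E g (map_action V E (inv\<^bsub>?G\<^esub> g) \<rho>) = \<rho>"
    if g: "g \<in> carrier ?G" and \<rho>: "\<rho> \<in> ?R" for g \<rho>
    using map_action_compose[OF inv_closed[OF g] g \<rho>] map_action_compose[OF g inv_closed[OF g] \<rho>]
      l_inv[OF g] r_inv[OF g] map_action_id[OF \<rho>] by (simp_all add: one mult)
  have bij: "map_action V E g \<in> Bij ?R" if g: "g \<in> carrier ?G" for g
  proof -
    have "bij_betw (map_action V E g) ?R ?R"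
      by (rule bij_betw_byWitness[where f' = "map_action V E (inv\<^bsub>?G\<^esub> g)"])
        (use cancel[OF g] map_action_closed[OF g] map_action_closed[OF inv_closed[OF g]] in auto)
    moreover have "map_action V E g \<in> extensional ?R" by (simp add: map_action_def)
    ultimately show ?thesis by (simp add: Bij_def)
  qed
  have "map_action V E (x \<circ> y) = compose ?R (map_action V E x) (map_action V E y)"
    if "x \<in> carrier ?G" "y \<in> carrier ?G" for x y
  proof
    fix \<rho> show "map_action V E (x \<circ> y) \<rho> = compose ?R (map_action V E x) (map_action V E y) \<rho>"
      using map_action_compose[OF that] by (cases "\<rho> \<in> ?R") (simp_all add: compose_def map_action_def)
  qed
  then have "map_action V E \<in> hom ?G (BijGroup ?R)"
    using bij by (auto simp: hom_def BijGroup_def mult)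
  then show ?thesis
    by (intro group_action.intro group_hom.intro group_hom_axioms.intro is_group group_BijGroup)
qed

end

theory Submission
  imports Defs "HOL-Combinatorics.Cycles" "HOL-Combinatorics.Multiset_Permutations"
    "HOL-Algebra.Multiplicative_Group"
begin

text \<open>
  Let \<open>m = n - 1\<close>. An automorphism of a map commutes with the rotation \<open>\<sigma>\<close> at the root, an \<open>m\<close>-cycle,
  so it is a power of \<open>\<sigma>\<close>; hence the automorphism group is always cyclic and semiregular off the
  root, and being \<open>d\<close>-fold symmetric only means having \<open>d\<close> automorphisms. For fixed \<open>\<sigma>\<close> and \<open>k dvd m\<close>,
  the order of the automorphism group is a multiple of \<open>k\<close> iff \<open>\<sigma> ^^ (m div k)\<close> is an automorphism,
  which holds for \<open>((m - 1)!) ^ (m div k)\<close> maps. Moebius inversion gives the number of maps with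
  exactly \<open>d\<close> automorphisms, and the orbit-stabilizer theorem turns it into a number of orbits.
\<close>

section \<open>Powers of a rotation and permutations commuting with it\<close>

text \<open>The orbit of \<open>x\<close> is all of \<open>N\<close>, and the exponents below the
  first return time of \<open>x\<close> enumerate it without repetition. The return time is
  therefore \<open>card N\<close>.\<close>

lemma is_rotation_funpow:
  assumes "finite N" and rot: "is_rotation N \<sigma>" and x: "x \<in> N"
  shows is_rotation_funpow_card: "(\<sigma> ^^ card N) x = x"
    and is_rotation_funpow_image: "(\<lambda>i. (\<sigma> ^^ i) x) ` {..<card N} = N"
    and is_rotation_funpow_inj: "inj_on (\<lambda>i. (\<sigma> ^^ i) x) {..<card N}"
proof -
  \<comment> \<open>\<open>funpow_dist1\<close> is the least positive exponent leading from
    \<open>x\<close> back to \<open>x\<close>.\<close>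
  define l where "l = funpow_dist1 \<sigma> x x"
  have N: "Orbits.orbit \<sigma> x = N"
    using rot x orbit_cyclic_eq3[of \<sigma> N x] by (simp add: is_rotation_def)
  then have x': "x \<in> Orbits.orbit \<sigma> x" using x by simp
  have im: "(\<lambda>i. (\<sigma> ^^ i) x) ` {..<l} = N"
    using orbit_conv_funpow_dist1[OF x'] unfolding N l_def by (simp add: atLeast0LessThan)
  have inj: "inj_on (\<lambda>i. (\<sigma> ^^ i) x) {..<l}"
    using inj_on_funpow_dist1[OF x'] unfolding l_def by (simp add: atLeast0LessThan)
  have l: "l = card N" using card_image[OF inj] im by simp
  show "(\<sigma> ^^ card N) x = x"
    using funpow_dist1_prop[OF x'] unfolding l[symmetric] l_def .
  show "(\<lambda>i. (\<sigma> ^^ i) x) ` {..<card N} = N" "inj_on (\<lambda>i. (\<sigma> ^^ i) x) {..<card N}"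
    using im inj by (simp_all add: l)
qed

lemma is_rotation_funpow_eq_iff:
  assumes "finite N" and "is_rotation N \<sigma>" and "x \<in> N"
  shows "(\<sigma> ^^ i) x = (\<sigma> ^^ j) x \<longleftrightarrow> i mod card N = j mod card N"
proof -
  have pos: "card N > 0" using assms by (auto simp: card_gt_0_iff)
  have mod: "(\<sigma> ^^ (i mod card N)) x = (\<sigma> ^^ i) x" for i
    using funpow_mod_eq[OF is_rotation_funpow_card[OF assms]] .
  have "(\<sigma> ^^ (i mod card N)) x = (\<sigma> ^^ (j mod card N)) x \<longleftrightarrow> i mod card N = j mod card N"
    using is_rotation_funpow_inj[OF assms] pos by (auto dest!: inj_onD)
  then show ?thesis by (simp add: mod)
qed

lemma is_rotation_funpow_cong:
  assumes "finite N" and rot: "is_rotation N \<sigma>" and "i mod card N = j mod card N"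
  shows "\<sigma> ^^ i = \<sigma> ^^ j"
proof
  fix y
  have "\<sigma> permutes N" using rot by (simp add: is_rotation_def)
  then have "y \<notin> N \<Longrightarrow> (\<sigma> ^^ i) y = y" for i
    using permutes_funpow permutes_not_in by metis
  then show "(\<sigma> ^^ i) y = (\<sigma> ^^ j) y"
    using is_rotation_funpow_eq_iff[OF assms(1,2)] assms(3) by (cases "y \<in> N") auto
qed

lemma is_rotation_obtain_funpow:
  assumes "finite N" and "is_rotation N \<sigma>" and "x \<in> N" and "y \<in> N"
  obtains i where "i < card N" and "y = (\<sigma> ^^ i) x"
  using is_rotation_funpow_image[OF assms(1-3)] assms(4) by auto

text \<open>Commuting with a transitive cycle fixes all values of \<tau> on \<open>N\<close> once
  its value at one point \<open>x\<close> is known. The exponent is read off from the position of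
  \<open>\<tau> x\<close> on the cycle through \<open>x\<close>.\<close>

lemma is_rotation_commuting_eq_funpow:
  assumes fin: "finite N" and rot: "is_rotation N \<sigma>" and \<tau>: "\<tau> permutes N" and comm: "\<tau> \<circ> \<sigma> = \<sigma> \<circ> \<tau>"
  obtains i where "\<tau> = \<sigma> ^^ i"
proof -
  obtain x where x: "x \<in> N" using rot by (auto simp: is_rotation_def cyclic_on_def)
  have "\<tau> x \<in> N" using \<tau> x by (simp add: permutes_in_image)
  then obtain i where i: "\<tau> x = (\<sigma> ^^ i) x"
    using is_rotation_obtain_funpow[OF fin rot x] by metis
  have comm': "\<tau> ((\<sigma> ^^ j) z) = (\<sigma> ^^ j) (\<tau> z)" for j z
    using comm by (induction j) (auto simp: fun_eq_iff)
  have "\<tau> y = (\<sigma> ^^ i) y" for y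
  proof (cases "y \<in> N")
    case True
    then obtain j where "y = (\<sigma> ^^ j) x" using is_rotation_obtain_funpow[OF fin rot x] by metis
    then show ?thesis by (simp add: comm' i flip: funpow_add comp_apply[of "\<sigma> ^^ _" "\<sigma> ^^ _"])
      (simp add: add.commute)
  next
    case False
    have "\<sigma> permutes N" using rot by (simp add: is_rotation_def)
    then have "\<sigma> ^^ i permutes N" by (rule permutes_funpow)
    with False \<tau> show ?thesis by (simp add: permutes_not_in)
  qed
  then show thesis using that by blast
qed

section \<open>Counting the rotations of a finite set\<close>

text \<open>Applying the i-th power of the cycle to every entry of \<open>xs\<close> rotates the
  list by i places, so the head is sent to the entry at position i, taken cyclically. This shows in
  \<open>card_rotations\<close> that every ordering of the set arises.\<close>

lemma is_rotation_cycle_of_list: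
  assumes "distinct xs" and "xs \<noteq> []"
  shows "is_rotation (set xs) (cycle_of_list xs)"
    and "i < length xs \<Longrightarrow> (cycle_of_list xs ^^ i) (hd xs) = xs ! i"
proof -
  let ?\<pi> = "cycle_of_list xs"
  have nth: "(?\<pi> ^^ i) (hd xs) = xs ! (i mod length xs)" for i
  proof -
    have "(?\<pi> ^^ i) (hd xs) = hd (map (?\<pi> ^^ i) xs)" using assms by (simp add: hd_map)
    also have "\<dots> = hd (rotate i xs)" using cyclic_rotation[of xs] assms by simp
    finally show ?thesis using assms by (simp add: hd_rotate_conv_nth)
  qed
  then show "i < length xs \<Longrightarrow> (?\<pi> ^^ i) (hd xs) = xs ! i" by simp
  have "Orbits.orbit ?\<pi> (hd xs) = range (\<lambda>i. xs ! (i mod length xs))"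
    unfolding orbit_altdef_permutation[OF permutation_of_cycle] nth by auto
  also have "\<dots> = set xs"
  proof (intro equalityI subsetI)
    fix y assume "y \<in> set xs"
    then obtain i where "i < length xs" "xs ! i = y" by (auto simp: in_set_conv_nth)
    then show "y \<in> range (\<lambda>i. xs ! (i mod length xs))" by (intro range_eqI[of _ _ i]) simp
  qed (use assms in auto)
  finally have "cyclic_on ?\<pi> (set xs)"
    unfolding cyclic_on_def using hd_in_set[OF assms(2)] by metis
  then show "is_rotation (set xs) ?\<pi>"
    by (simp add: is_rotation_def cycle_permutes)
qed

lemma finite_rotations:
  assumes "finite N"
  shows "finite {\<pi>. is_rotation N \<pi>}"
  using finite_subset[OF _ finite_permutations[OF assms]] by (auto simp: is_rotation_def)

text \<open>A rotation together with a starting point is the same as a linear order of the set.\<close>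

lemma card_rotations:
  assumes fin: "finite N" and ne: "N \<noteq> {}"
  shows "card {\<pi>. is_rotation N \<pi>} = fact (card N - 1)"
proof -
  let ?Rot = "{\<pi>. is_rotation N \<pi>}"
  define m where "m = card N"
  have m: "m > 0" using fin ne by (simp add: m_def card_gt_0_iff)
  let ?F = "\<lambda>(\<pi> :: 'a \<Rightarrow> 'a, x). map (\<lambda>i. (\<pi> ^^ i) x) [0..<m]"
  have "inj_on ?F (?Rot \<times> N)"
  proof (rule inj_onI, clarify)
    fix \<pi> x \<pi>' x'
    assume rot: "is_rotation N \<pi>" "is_rotation N \<pi>'" and x: "x \<in> N" "x' \<in> N"
      and eq: "map (\<lambda>i. (\<pi> ^^ i) x) [0..<m] = map (\<lambda>i. (\<pi>' ^^ i) x') [0..<m]"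
    have eq': "(\<pi> ^^ i) x = (\<pi>' ^^ i) x'" if "i < m" for i
      using eq that by (auto simp: map_eq_conv)
    have xx: "x = x'" using eq'[OF m] by simp
    \<comment> \<open>The equality is extended to \<open>i = m\<close>, where both cycles return to
      \<open>x\<close>, so that the successor of the last listed point is covered too.\<close>
    have eqm: "(\<pi> ^^ i) x = (\<pi>' ^^ i) x" if "i \<le> m" for i
      using that eq' xx is_rotation_funpow_card[OF fin] rot x unfolding m_def
      by (metis le_neq_implies_less)
    have "\<pi> y = \<pi>' y" for y
    proof (cases "y \<in> N")
      case True
      then obtain i where i: "i < m" "y = (\<pi> ^^ i) x"
        using is_rotation_obtain_funpow[OF fin rot(1) x(1)] unfolding m_def by metis
      then show ?thesis using eqm[of i] eqm[of "Suc i"] by simp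
    next
      case False
      then show ?thesis using rot by (simp add: is_rotation_def) (metis permutes_not_in)
    qed
    then show "\<pi> = \<pi>' \<and> x = x'" using xx by blast
  qed
  moreover have "?F ` (?Rot \<times> N) = permutations_of_set N"
  proof (intro equalityI subsetI)
    fix xs assume "xs \<in> ?F ` (?Rot \<times> N)"
    then obtain \<pi> x where "is_rotation N \<pi>" "x \<in> N" "xs = map (\<lambda>i. (\<pi> ^^ i) x) [0..<m]"
      by auto
    then show "xs \<in> permutations_of_set N"
      using is_rotation_funpow_image[OF fin] is_rotation_funpow_inj[OF fin]
      by (simp add: permutations_of_set_def distinct_map m_def atLeast0LessThan)
  next
    fix xs assume "xs \<in> permutations_of_set N"
    then have xs: "distinct xs" "set xs = N" "xs \<noteq> []" "length xs = m"
      using ne by (auto simp: permutations_of_set_def m_def distinct_card)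
    have "xs = ?F (cycle_of_list xs, hd xs)"
      using is_rotation_cycle_of_list(2)[OF xs(1,3)] xs(4) by (auto intro: nth_equalityI)
    moreover have "(cycle_of_list xs, hd xs) \<in> ?Rot \<times> N"
      using is_rotation_cycle_of_list(1)[OF xs(1,3)] xs by auto
    ultimately show "xs \<in> ?F ` (?Rot \<times> N)" by (rule image_eqI)
  qed
  ultimately have "card (?Rot \<times> N) = card (permutations_of_set N)"
    using card_image by fastforce
  then have "card ?Rot * m = fact m"
    by (simp add: card_cartesian_product fin m_def)
  also have "\<dots> = fact (m - 1) * m" using m fact_reduce[of m, where 'a=nat] by simp
  finally show ?thesis using m by (simp add: m_def)
qed

section \<open>Moebius inversion over multiples\<close>

text \<open>Only squarefree divisors contribute, and they correspond to the sets of prime factors of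
  \<open>n\<close>. The sum of \<open>(-1) ^ card S\<close> over these sets is the expansion of a
  product of factors \<open>(-1) + 1\<close>, which vanishes unless it is empty.\<close>

lemma sum_moebius_mu_divisors:
  assumes "n > 0"
  shows "(\<Sum>k | k dvd n. moebius_mu k) = (if n = 1 then 1 else 0)"
proof -
  let ?P = "prime_factors n"
  have P: "prime p" if "p \<in> ?P" for p using that by auto
  have pf: "prime_factors (\<Prod>S) = S" if "S \<subseteq> ?P" for S
  proof -
    have "finite S" using that finite_subset by blast
    then show ?thesis using that
      by (subst prime_factors_prod) (auto simp: prime_factorization_prime[OF P] subset_eq)
  qed
  have sqf: "squarefree (\<Prod>S)" if "S \<subseteq> ?P" for S
    using that by (intro squarefree_prod_coprime) (auto intro: primes_coprime squarefree_prime)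
  have dvd: "\<Prod>S dvd n" if "S \<subseteq> ?P" for S
  proof -
    have "\<Prod>S dvd \<Prod>?P" using that by (intro prod_dvd_prod_subset) auto
    also have "\<dots> dvd (\<Prod>p\<in>?P. p ^ multiplicity p n)"
      by (intro prod_dvd_prod) (auto simp: prime_factors_multiplicity intro!: dvd_power)
    also have "\<dots> = n" using assms prime_factorization_nat[of n] by simp
    finally show ?thesis .
  qed
  have "(\<Sum>k | k dvd n. moebius_mu k) = (\<Sum>k | k dvd n \<and> squarefree k. (-1) ^ card (prime_factors k))"
    using assms by (intro sum.mono_neutral_cong_right) (auto simp: moebius_mu_def)
  also have "\<dots> = (\<Sum>S\<in>Pow ?P. (-1) ^ card S)"
  proof (rule sum.reindex_bij_witness[where i = "\<lambda>S. \<Prod>S" and j = prime_factors])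
    fix k assume k: "k \<in> {k. k dvd n \<and> squarefree k}"
    then have "k \<noteq> 0" using assms by auto
    have "\<Prod>(prime_factors k) = (\<Prod>p\<in>prime_factors k. p ^ multiplicity p k)"
      using k \<open>k \<noteq> 0\<close> squarefree_factorial_semiring'[of k] by (intro prod.cong) auto
    also have "\<dots> = k" using \<open>k \<noteq> 0\<close> prime_factorization_nat[of k] by simp
    finally show "\<Prod>(prime_factors k) = k" .
    show "prime_factors k \<in> Pow ?P" using k assms by (simp add: dvd_prime_factors)
  qed (use pf sqf dvd in auto)
  also have "\<dots> = (\<Prod>p\<in>?P. (-1) + 1)" by (subst prod_add) auto
  also have "\<dots> = (if n = 1 then 1 else 0)"
    using assms prime_factorization_empty_iff[of n] by (simp add: power_0_left card_eq_0_iff)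
  finally show ?thesis .
qed

text \<open>After exchanging the sums, the coefficient of \<open>A e\<close> is the sum of
  \<open>moebius_mu (k div d)\<close> over all k between d and e in the divisibility order. Dividing
  by d turns it into a divisor sum for \<open>e div d\<close>, which vanishes unless
  \<open>e = d\<close>.\<close>

lemma moebius_inversion_multiples:
  fixes A :: "nat \<Rightarrow> 'b :: comm_ring_1"
  assumes "m > 0" and "d dvd m"
  shows "(\<Sum>k | d dvd k \<and> k dvd m. of_int (moebius_mu (k div d)) * (\<Sum>e | k dvd e \<and> e dvd m. A e)) = A d"
proof -
  have fin: "finite {k. P k \<and> k dvd m}" for P
    using assms by (intro finite_subset[OF _ finite_divisors_nat[of m]]) auto
  have d: "d > 0" using assms by (auto intro: Nat.gr0I)
  have inner: "(\<Sum>k | d dvd k \<and> k dvd e. moebius_mu (k div d)) = (if e = d then 1 else 0)"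
    if e: "d dvd e" "e dvd m" for e
  proof -
    obtain q where q: "e = d * q" using e by auto
    have "q > 0" using e assms unfolding q by (auto intro: Nat.gr0I)
    have "(\<Sum>k | d dvd k \<and> k dvd e. moebius_mu (k div d)) = (\<Sum>k | k dvd q. moebius_mu k)"
      by (rule sum.reindex_bij_witness[where i = "\<lambda>k. d * k" and j = "\<lambda>k. k div d"])
        (use d in \<open>auto simp: q\<close>)
    then show ?thesis using sum_moebius_mu_divisors[OF \<open>q > 0\<close>] d by (simp add: q)
  qed
  have "(\<Sum>k | d dvd k \<and> k dvd m. of_int (moebius_mu (k div d)) * (\<Sum>e | k dvd e \<and> e dvd m. A e))
      = (\<Sum>k | d dvd k \<and> k dvd m. \<Sum>e | k dvd e \<and> e dvd m. of_int (moebius_mu (k div d)) * A e)"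
    by (simp add: sum_distrib_left)
  also have "\<dots> = (\<Sum>(k, e) \<in> (SIGMA k : {k. d dvd k \<and> k dvd m}. {e. k dvd e \<and> e dvd m}). of_int (moebius_mu (k div d)) * A e)"
    using fin by (intro sum.Sigma) auto
  also have "\<dots> = (\<Sum>(e, k) \<in> (SIGMA e : {e. d dvd e \<and> e dvd m}. {k. d dvd k \<and> k dvd e}). of_int (moebius_mu (k div d)) * A e)"
    by (rule sum.reindex_bij_witness[where i = "\<lambda>(a, b). (b, a)" and j = "\<lambda>(a, b). (b, a)"])
      (auto intro: dvd_trans)
  also have "\<dots> = (\<Sum>e | d dvd e \<and> e dvd m. \<Sum>k | d dvd k \<and> k dvd e. of_int (moebius_mu (k div d)) * A e)"
  proof (intro sum.Sigma[symmetric] ballI)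
    fix e assume "e \<in> {e. d dvd e \<and> e dvd m}"
    then have "{k. d dvd k \<and> k dvd e} \<subseteq> {k. d dvd k \<and> k dvd m}" by (auto intro: dvd_trans)
    then show "finite {k. d dvd k \<and> k dvd e}" using fin finite_subset by blast
  qed (rule fin)
  also have "\<dots> = (\<Sum>e | d dvd e \<and> e dvd m. if e = d then A e else 0)"
  proof (intro sum.cong refl)
    fix e assume "e \<in> {e. d dvd e \<and> e dvd m}"
    then have "of_int (\<Sum>k | d dvd k \<and> k dvd e. moebius_mu (k div d)) * A e = (if e = d then A e else 0)"
      using inner[of e] by simp
    then show "(\<Sum>k | d dvd k \<and> k dvd e. of_int (moebius_mu (k div d)) * A e) = (if e = d then A e else 0)"
      by (simp add: sum_distrib_right)
  qed
  also have "\<dots> = A d" using fin assms by simp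
  finally show ?thesis .
qed

section \<open>Counting orbits by the order of their stabilizers\<close>

text \<open>By the orbit-stabilizer theorem the stabilizer order is constant on an orbit, and an
  orbit with stabilizers of order d satisfies \<open>d * card X = order G\<close>. Summing this over
  the orbits that partition \<open>E\<close> gives the identity.\<close>

lemma (in group_action) card_orbits_stabilizer_card:
  assumes fin: "finite E"
  shows "card {X \<in> orbits G E \<phi>. \<forall>x\<in>X. card (stabilizer G \<phi> x) = d} * order G =
    d * card {x \<in> E. card (stabilizer G \<phi> x) = d}"
proof -
  let ?s = "\<lambda>x. card (stabilizer G \<phi> x)"
  have finO: "finite (orbits G E \<phi>)"
    using orbits_coverture fin finite_UnionD by metis
  have orb: "d * (\<Sum>x\<in>X. if ?s x = d then 1 else 0) = (if \<forall>x\<in>X. ?s x = d then order G else 0)"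
    if X: "X \<in> orbits G E \<phi>" for X
  proof -
    have XE: "X \<subseteq> E" using X orbits_coverture by blast
    have size: "card X * ?s x = order G" if "x \<in> X" for x
    proof -
      \<comment> \<open>An element of \<open>orbits\<close> is given as the orbit of some
        representative; disjointness of distinct orbits makes it the orbit of each of its
        members.\<close>
      have "Group_Action.orbit G \<phi> x = X"
        using disjoint_union[OF _ X, of "Group_Action.orbit G \<phi> x"] orbit_refl[of x] that XE
        by (auto simp: orbits_def)
      then show ?thesis using orbit_stabilizer_theorem[of x] that XE by auto
    qed
    obtain x where x: "x \<in> X" using X orbit_refl by (auto simp: orbits_def)
    have "card X > 0" using x XE fin finite_subset by (auto simp: card_gt_0_iff)
    then have const: "?s y = ?s x" if "y \<in> X" for y
      using size[OF x] size[OF that] by (metis mult_left_cancel neq0_conv)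
    have sum_eq: "(\<Sum>y\<in>X. if ?s y = d then 1 else 0) = (\<Sum>y\<in>X. if ?s x = d then 1 else (0::nat))"
      by (rule sum.cong) (simp_all add: const)
    have all_eq: "(\<forall>y\<in>X. ?s y = d) \<longleftrightarrow> ?s x = d"
      using const x by metis
    show ?thesis
      unfolding sum_eq all_eq using size[OF x] by (auto simp: mult.commute)
  qed
  have "d * card {x \<in> E. ?s x = d} = d * (\<Sum>x\<in>E. if ?s x = d then 1 else 0)"
    using fin by (simp add: sum.If_cases Int_def conj_commute)
  also have "\<dots> = (\<Sum>X\<in>orbits G E \<phi>. d * (\<Sum>x\<in>X. if ?s x = d then 1 else 0))"
    by (simp only: disjoint_sum[OF fin, symmetric] sum_distrib_left)
  also have "\<dots> = (\<Sum>X\<in>orbits G E \<phi>. if \<forall>x\<in>X. ?s x = d then order G else 0)"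
    using orb by (rule sum.cong[OF refl])
  also have "\<dots> = card {X \<in> orbits G E \<phi>. \<forall>x\<in>X. ?s x = d} * order G"
    using finO by (simp add: sum.If_cases Int_def conj_commute)
  finally show ?thesis by simp
qed

section \<open>Conjugation of rotations\<close>

text \<open>The effect of \<open>map_action\<close> on the rotation at a single vertex, separated
  from the relabeling of the vertices.\<close>

definition conj_perm :: "('a \<Rightarrow> 'a) \<Rightarrow> ('a \<Rightarrow> 'a) \<Rightarrow> 'a \<Rightarrow> 'a" where
  "conj_perm p \<pi> = p \<circ> \<pi> \<circ> inv' p"

lemma conj_perm_comp:
  assumes "bij p" and "bij q"
  shows "conj_perm (p \<circ> q) \<pi> = conj_perm p (conj_perm q \<pi>)"
  using assms by (simp add: conj_perm_def o_inv_distrib comp_assoc)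

lemma conj_perm_id [simp]: "conj_perm id \<pi> = \<pi>"
  by (simp add: conj_perm_def)

lemma conj_perm_eq_self_iff:
  assumes "bij p"
  shows "conj_perm p \<pi> = \<pi> \<longleftrightarrow> p \<circ> \<pi> = \<pi> \<circ> p"
proof -
  have "inv' p \<circ> p = id" using bij_is_inj[OF assms] by simp
  moreover have "p \<circ> inv' p = id" using bij_is_surj[OF assms] by (simp only: surj_iff)
  ultimately show ?thesis
    unfolding conj_perm_def by (metis comp_assoc comp_id)
qed

lemma is_rotation_conj_perm:
  assumes p: "bij p" and rot: "is_rotation A \<pi>"
  shows "is_rotation (p ` A) (conj_perm p \<pi>)"
proof -
  have p': "p (inv' p x) = x" "inv' p (p x) = x" for x
    using p by (simp_all add: bij_is_inj bij_is_surj surj_f_inv_f)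
  have \<pi>: "\<pi> permutes A" "cyclic_on \<pi> A" using rot by (simp_all add: is_rotation_def)
  have "bij (conj_perm p \<pi>)"
    unfolding conj_perm_def by (intro bij_comp bij_imp_bij_inv p permutes_bij[OF \<pi>(1)])
  moreover have "conj_perm p \<pi> x = x" if "x \<notin> p ` A" for x
  proof -
    have "inv' p x \<notin> A" using that p'(1)[of x] by (metis imageI)
    then show ?thesis using \<pi>(1) by (simp add: conj_perm_def p' permutes_not_in)
  qed
  ultimately have "conj_perm p \<pi> permutes p ` A"
    unfolding permutes_def bij_iff by blast
  moreover have "cyclic_on (conj_perm p \<pi>) (p ` A)"
    using \<pi>(2) by (rule cyclic_on_image) (simp add: conj_perm_def p')
  ultimately show ?thesis by (simp add: is_rotation_def)
qed

section \<open>Automorphism groups of maps on the rooted complete graph\<close>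

text \<open>The assumption \<open>ne\<close> expresses that there are at least two vertices; it
  makes \<open>m\<close> positive and provides a base point on the cycle at the root.\<close>

locale rooted_complete_graph =
  fixes V :: "'a set" and r :: 'a
  assumes finite_V: "finite V" and root_in: "r \<in> V" and ne: "V - {r} \<noteq> {}"
begin

abbreviation "N \<equiv> V - {r}"
abbreviation "m \<equiv> card N"
abbreviation "G \<equiv> rooted_aut_group V (complete_edges V) r"
abbreviation "R \<equiv> rotation_systems V (complete_edges V)"
abbreviation "stab \<equiv> map_aut_group V (complete_edges V) r"

lemma finite_N: "finite N"
  using finite_V by simp

lemma m_pos: "m > 0"
  using finite_N ne by (simp add: card_gt_0_iff)

lemma rotation_systems_eq: "R = (\<Pi>\<^sub>E v\<in>V. {\<pi>. is_rotation (V - {v}) \<pi>})"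
  unfolding rotation_systems_def by (intro PiE_cong) (simp add: neighborhood_complete)

lemma finite_R: "finite R"
  unfolding rotation_systems_eq using finite_V by (intro finite_PiE finite_rotations) auto

lemma root_rotation: "\<rho> \<in> R \<Longrightarrow> is_rotation N (\<rho> r)"
  using root_in by (auto simp: rotation_systems_eq PiE_def Pi_def)

lemma carrier_G: "carrier G = {\<gamma>. \<gamma> permutes N}"
proof -
  have "\<gamma> permutes N \<longleftrightarrow> \<gamma> permutes V \<and> \<gamma> r = r" for \<gamma>
  proof
    assume "\<gamma> permutes N"
    then show "\<gamma> permutes V \<and> \<gamma> r = r"
      by (auto simp: permutes_not_in intro: permutes_subset)
  next
    assume "\<gamma> permutes V \<and> \<gamma> r = r"
    then show "\<gamma> permutes N" by (auto intro: permutes_superset[of \<gamma> V])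
  qed
  then show ?thesis by (simp add: carrier_rooted_aut_group_complete)
qed

lemma finite_G: "finite (carrier G)"
  unfolding carrier_G using finite_N by (rule finite_permutations)

lemma order_G: "order G = fact m"
  unfolding order_def carrier_G by (rule card_permutations[OF refl finite_N])

lemma mult_G: "x \<otimes>\<^bsub>G\<^esub> y = x \<circ> y"
  by (simp add: rooted_aut_group_def)

lemma nat_pow_G: "x [^]\<^bsub>G\<^esub> (k :: nat) = x ^^ k"
proof -
  interpret group G by (rule group_rooted_aut_group)
  show ?thesis
  proof (induction k)
    case 0 show ?case by (simp add: rooted_aut_group_def)
  next
    case (Suc k) then show ?case by (simp add: mult_G funpow_swap1 fun_eq_iff)
  qed
qed

lemma stab_iff:
  assumes \<rho>: "\<rho> \<in> R"
  shows "\<gamma> \<in> stab \<rho> \<longleftrightarrow> \<gamma> permutes N \<and> (\<forall>v\<in>V. \<rho> (\<gamma> v) = conj_perm \<gamma> (\<rho> v))"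
proof (cases "\<gamma> permutes N")
  case True
  then have G: "\<gamma> \<in> carrier G" by (simp add: carrier_G)
  have pV: "\<gamma> permutes V" using True by (rule permutes_subset) auto
  let ?a = "map_action V (complete_edges V) \<gamma> \<rho>"
  have "?a \<in> R" using map_action_closed[OF G \<rho>] .
  then have "?a = \<rho> \<longleftrightarrow> (\<forall>u\<in>V. ?a u = \<rho> u)"
    using \<rho> unfolding rotation_systems_eq by (auto intro: PiE_ext)
  \<comment> \<open>Substituting \<open>u = \<gamma> v\<close> removes the inverse of \<gamma> from
    the vertex argument of the action.\<close>
  also have "\<dots> \<longleftrightarrow> (\<forall>v\<in>V. ?a (\<gamma> v) = \<rho> (\<gamma> v))"
    using permutes_image[OF pV] by (metis imageE imageI)
  also have "\<dots> \<longleftrightarrow> (\<forall>v\<in>V. \<rho> (\<gamma> v) = conj_perm \<gamma> (\<rho> v))"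
    using map_action_apply[OF G \<rho>] by (auto simp: conj_perm_def)
  finally show ?thesis
    using True G by (simp add: map_aut_group_def stabilizer_def)
next
  case False
  then show ?thesis by (simp add: map_aut_group_def stabilizer_def carrier_G)
qed

text \<open>An automorphism fixes the root, so invariance of the rotation there says that it
  commutes with that rotation.\<close>

lemma stab_funpow:
  assumes \<rho>: "\<rho> \<in> R" and \<gamma>: "\<gamma> \<in> stab \<rho>"
  obtains i where "\<gamma> = \<rho> r ^^ i"
proof -
  have p: "\<gamma> permutes N" and "\<rho> (\<gamma> r) = conj_perm \<gamma> (\<rho> r)"
    using \<gamma> root_in stab_iff[OF \<rho>] by auto
  moreover have "\<gamma> r = r" using p by (simp add: permutes_not_in)
  ultimately have "\<gamma> \<circ> \<rho> r = \<rho> r \<circ> \<gamma>"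
    using conj_perm_eq_self_iff[OF permutes_bij[OF p]] by metis
  then show thesis
    using is_rotation_commuting_eq_funpow[OF finite_N root_rotation[OF \<rho>] p] that by metis
qed

lemma subgroup_stab: "\<rho> \<in> R \<Longrightarrow> subgroup (stab \<rho>) G"
  unfolding map_aut_group_def
  by (rule group_action.stabilizer_subgroup[OF group_action_map_action])

text \<open>The stabilizer is a subgroup of the cyclic group generated by the root rotation, hence
  generated by its smallest positive power \<open>t\<close> in the stabilizer. Since the m-th power
  is the identity, \<open>t\<close> divides \<open>m\<close>.\<close>

lemma stab_generator:
  assumes \<rho>: "\<rho> \<in> R"
  obtains t where "t dvd m" and "stab \<rho> = range (\<lambda>j. (\<rho> r ^^ t) ^^ j)" and "card (stab \<rho>) = m div t"
    and "\<And>i. \<rho> r ^^ i \<in> stab \<rho> \<longleftrightarrow> t dvd i"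
proof -
  let ?\<sigma> = "\<rho> r" and ?H = "stab \<rho>"
  note rot = root_rotation[OF \<rho>]
  obtain x where x: "x \<in> N" using ne by blast
  interpret H: subgroup ?H G by (rule subgroup_stab[OF \<rho>])
  have cl: "a \<circ> b \<in> ?H" if "a \<in> ?H" "b \<in> ?H" for a b
    using H.m_closed[OF that] by (simp add: mult_G)
  have id: "id \<in> ?H" using H.one_closed by (simp add: rooted_aut_group_def)
  have cong: "?\<sigma> ^^ i = ?\<sigma> ^^ j" if "i mod m = j mod m" for i j
    using that by (rule is_rotation_funpow_cong[OF finite_N rot])
  have \<sigma>m: "?\<sigma> ^^ m = id" using cong[of m 0] by simp
  define t where "t = (LEAST t. t > 0 \<and> ?\<sigma> ^^ t \<in> ?H)"
  have t: "t > 0" "?\<sigma> ^^ t \<in> ?H"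
    using LeastI[of "\<lambda>t. t > 0 \<and> ?\<sigma> ^^ t \<in> ?H" m] m_pos id unfolding t_def by (simp_all add: \<sigma>m)
  have least: "\<not> (0 < i \<and> i < t \<and> ?\<sigma> ^^ i \<in> ?H)" for i
    using not_less_Least[of i "\<lambda>t. t > 0 \<and> ?\<sigma> ^^ t \<in> ?H"] unfolding t_def by blast
  have mult: "?\<sigma> ^^ (t * j) \<in> ?H" for j
  proof (induction j)
    case 0 show ?case using id by (simp add: id_def)
  next
    case (Suc j)
    have "?\<sigma> ^^ (t * Suc j) = ?\<sigma> ^^ t \<circ> ?\<sigma> ^^ (t * j)"
      by (simp only: mult_Suc_right funpow_add)
    then show ?case using cl[OF t(2) Suc] by (simp only:)
  qed
  have iff: "?\<sigma> ^^ i \<in> ?H \<longleftrightarrow> t dvd i" for i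
  proof
    assume i: "?\<sigma> ^^ i \<in> ?H"
    define q where "q = i div t"
    have iq: "i = i mod t + t * q" by (simp add: q_def)
    \<comment> \<open>Exponents are natural numbers, so instead of subtracting \<open>t * q\<close>
      one adds \<open>t * q * (m - 1)\<close>; the two differ by a multiple of
      \<open>m\<close>.\<close>
    have "i + t * (q * (m - 1)) = i mod t + t * q + t * q * (m - 1)" using iq by (simp add: mult.assoc)
    also have "\<dots> = i mod t + t * q * m" using m_pos by (cases m) auto
    finally have "?\<sigma> ^^ (i + t * (q * (m - 1))) = ?\<sigma> ^^ (i mod t)" by (intro cong) simp
    then have "?\<sigma> ^^ (i mod t) \<in> ?H" using cl[OF i mult[of "q * (m - 1)"]] by (simp only: funpow_add)
    then have "i mod t = 0" using least[of "i mod t"] t(1) by auto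
    then show "t dvd i" by auto
  qed (auto simp: mult)
  have dvd: "t dvd m" using iff[of m] id by (simp add: \<sigma>m)
  then obtain k where k: "m = t * k" by auto
  have "k > 0" using m_pos k by (auto intro: Nat.gr0I)
  have H: "?H = range (\<lambda>j. (?\<sigma> ^^ t) ^^ j)"
  proof (intro equalityI subsetI)
    fix \<gamma> assume "\<gamma> \<in> ?H"
    then obtain i where "\<gamma> = ?\<sigma> ^^ i" "t dvd i" using stab_funpow[OF \<rho>] iff by metis
    then show "\<gamma> \<in> range (\<lambda>j. (?\<sigma> ^^ t) ^^ j)" by (auto simp: funpow_mult)
  qed (use mult in \<open>auto simp: funpow_mult\<close>)
  have "?H = (\<lambda>j. ?\<sigma> ^^ (t * j)) ` {..<k}"
  proof (intro equalityI subsetI)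
    fix \<gamma> assume "\<gamma> \<in> ?H"
    then obtain j where "\<gamma> = ?\<sigma> ^^ (t * j)" by (auto simp: H funpow_mult)
    also have "\<dots> = ?\<sigma> ^^ (t * (j mod k))" by (intro cong) (simp only: k mult_mod_right mod_mod_trivial)
    finally show "\<gamma> \<in> (\<lambda>j. ?\<sigma> ^^ (t * j)) ` {..<k}" using \<open>k > 0\<close> by auto
  qed (use mult in auto)
  moreover have "inj_on (\<lambda>j. ?\<sigma> ^^ (t * j)) {..<k}"
  proof (rule inj_onI)
    fix i j assume ij: "i \<in> {..<k}" "j \<in> {..<k}" and "?\<sigma> ^^ (t * i) = ?\<sigma> ^^ (t * j)"
    then have "(t * i) mod m = (t * j) mod m"
      using is_rotation_funpow_eq_iff[OF finite_N rot x] by metis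
    then show "i = j" using ij t(1) by (simp add: k)
  qed
  ultimately have "card ?H = k" by (simp add: card_image)
  then have card: "card ?H = m div t" using k t(1) by simp
  show thesis by (rule that[OF dvd H card iff])
qed

lemma card_stab_dvd: "\<rho> \<in> R \<Longrightarrow> card (stab \<rho>) dvd m"
  by (erule stab_generator) (metis dvd_mult_div_cancel dvd_triv_right)

text \<open>With \<open>t\<close> from \<open>stab_generator\<close>, both sides are equivalent to
  \<open>t * k dvd m\<close>.\<close>

lemma dvd_card_stab_iff:
  assumes \<rho>: "\<rho> \<in> R" and k: "k dvd m"
  shows "k dvd card (stab \<rho>) \<longleftrightarrow> \<rho> r ^^ (m div k) \<in> stab \<rho>"
proof -
  obtain t where t: "t dvd m" "card (stab \<rho>) = m div t" "\<And>i. \<rho> r ^^ i \<in> stab \<rho> \<longleftrightarrow> t dvd i"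
    using stab_generator[OF \<rho>] by metis
  have "t \<noteq> 0" "k \<noteq> 0" using t(1) k m_pos by auto
  have "k dvd m div t \<longleftrightarrow> t * k dvd m" using dvd_div_iff_mult[OF \<open>t \<noteq> 0\<close> t(1), of k] by (simp only: mult.commute)
  also have "\<dots> \<longleftrightarrow> t dvd m div k" using dvd_div_iff_mult[OF \<open>k \<noteq> 0\<close> k, of t] by simp
  finally show ?thesis by (simp add: t)
qed

text \<open>The stabilizer is always generated by a power of the root rotation. Two such powers that
  agree at one nonroot vertex are equal, so evaluation at that vertex is a bijection from the
  stabilizer onto the orbit of the generator.\<close>

lemma d_fold_symmetric_iff:
  assumes \<rho>: "\<rho> \<in> R"
  shows "d_fold_symmetric V (complete_edges V) r d \<rho> \<longleftrightarrow> card (stab \<rho>) = d"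
proof
  assume d: "card (stab \<rho>) = d"
  obtain t where H: "stab \<rho> = range (\<lambda>j. (\<rho> r ^^ t) ^^ j)" using stab_generator[OF \<rho>] by metis
  let ?\<gamma> = "\<rho> r ^^ t"
  note rot = root_rotation[OF \<rho>]
  have "\<rho> r permutes N" using rot by (simp add: is_rotation_def)
  then have p: "?\<gamma> permutes N" by (rule permutes_funpow)
  then have G: "?\<gamma> \<in> carrier G" by (simp add: carrier_G)
  interpret group G by (rule group_rooted_aut_group)
  \<comment> \<open>In a finite group the nonnegative powers of an element already form the subgroup
    that it generates.\<close>
  have "generate G {?\<gamma>} = stab \<rho>"
    unfolding generate_pow_on_finite_carrier[OF finite_G G] nat_pow_G H by auto
  moreover have "card (Orbits.orbit ?\<gamma> v) = d" if v: "v \<in> N" for v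
  proof -
    \<comment> \<open>\<open>Orbits.orbit\<close> collects positive powers only; for a permutation
      of finite support the zeroth power may be added, which matches the identity in the
      stabilizer.\<close>
    have "permutation ?\<gamma>" using p finite_N permutation_permutes by blast
    then have "Orbits.orbit ?\<gamma> v = (\<lambda>h. h v) ` stab \<rho>"
      unfolding orbit_altdef_permutation[OF \<open>permutation ?\<gamma>\<close>] H by auto
    moreover have "inj_on (\<lambda>h. h v) (stab \<rho>)"
    proof (rule inj_onI)
      fix a b assume "a \<in> stab \<rho>" "b \<in> stab \<rho>" and eq: "a v = b v"
      then obtain i j where ij: "a = \<rho> r ^^ i" "b = \<rho> r ^^ j"
        using stab_funpow[OF \<rho>] by metis
      then have "i mod m = j mod m"
        using eq is_rotation_funpow_eq_iff[OF finite_N rot v] by simp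
      then show "a = b" unfolding ij by (rule is_rotation_funpow_cong[OF finite_N rot])
    qed
    ultimately show ?thesis using d by (simp add: card_image)
  qed
  ultimately show "d_fold_symmetric V (complete_edges V) r d \<rho>"
    unfolding d_fold_symmetric_def using d G by (intro conjI bexI[of _ ?\<gamma>]) auto
qed (simp add: d_fold_symmetric_def)

section \<open>Maps invariant under a power of the root rotation\<close>

text \<open>A map with root rotation \<open>\<sigma>\<close> that is invariant under \<open>\<sigma> ^^ s\<close> is determined by arbitrary
  rotations at \<open>s\<close> consecutive vertices of the cycle \<open>\<sigma>\<close>, which represent the orbits of \<open>\<sigma> ^^ s\<close>.\<close>

lemma card_invariant_maps:
  assumes rot: "is_rotation N \<sigma>" and s: "s dvd m"
  shows "card {\<rho> \<in> R. \<rho> r = \<sigma> \<and> \<sigma> ^^ s \<in> stab \<rho>} = fact (m - 1) ^ s"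
proof -
  let ?A = "{\<rho> \<in> R. \<rho> r = \<sigma> \<and> \<sigma> ^^ s \<in> stab \<rho>}"
  obtain x where x: "x \<in> N" using ne by blast
  define v where "v j = (\<sigma> ^^ j) x" for j
  define g where "g = \<sigma> ^^ s"
  define B where "B = (\<Pi>\<^sub>E i\<in>{..<s}. {\<pi>. is_rotation (V - {v i}) \<pi>})"
  have "s > 0" using s m_pos by (auto intro: Nat.gr0I)
  have \<sigma>: "\<sigma> permutes N" using rot by (simp add: is_rotation_def)
  have pN: "\<sigma> ^^ i permutes N" for i using \<sigma> by (rule permutes_funpow)
  have pV: "\<sigma> ^^ i permutes V" for i using pN by (rule permutes_subset) auto
  have bij: "bij (\<sigma> ^^ i)" for i using pN by (rule permutes_bij)
  have vN: "v j \<in> N" for j unfolding v_def using x permutes_in_image[OF pN] by blast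
  then have vV: "v j \<in> V" "v j \<noteq> r" for j by blast+
  have fix_r: "(\<sigma> ^^ i) r = r" for i using pN permutes_not_in by fastforce
  have \<sigma>v: "(\<sigma> ^^ i) (v j) = v (i + j)" for i j by (simp add: v_def funpow_add)
  have v_eq: "v i = v j \<longleftrightarrow> i mod m = j mod m" for i j
    unfolding v_def by (rule is_rotation_funpow_eq_iff[OF finite_N rot x])
  have v_ex: "\<exists>j. u = v j" if "u \<in> N" for u
    using is_rotation_obtain_funpow[OF finite_N rot x that] unfolding v_def by metis
  have cong: "\<sigma> ^^ i = \<sigma> ^^ j" if "i mod m = j mod m" for i j
    using that by (rule is_rotation_funpow_cong[OF finite_N rot])
  have inv_iff: "\<sigma> ^^ s \<in> stab \<rho> \<longleftrightarrow> (\<forall>j. \<rho> (v (s + j)) = conj_perm g (\<rho> (v j)))"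
    if \<rho>: "\<rho> \<in> R" "\<rho> r = \<sigma>" for \<rho>
  proof -
    \<comment> \<open>At the root, invariance is automatic because a power of \<sigma> commutes with
      \<sigma>; only the conditions at the other vertices remain.\<close>
    have "conj_perm g \<sigma> = \<sigma>"
      unfolding g_def conj_perm_eq_self_iff[OF bij] by (simp add: fun_eq_iff funpow_swap1)
    then have "\<sigma> ^^ s \<in> stab \<rho> \<longleftrightarrow> (\<forall>u\<in>N. \<rho> (g u) = conj_perm g (\<rho> u))"
      using stab_iff[OF \<rho>(1)] pN[of s] \<rho>(2) root_in fix_r[of s] unfolding g_def by auto
    also have "\<dots> \<longleftrightarrow> (\<forall>j. \<rho> (g (v j)) = conj_perm g (\<rho> (v j)))"
      using vN v_ex by metis
    finally show ?thesis by (simp add: g_def \<sigma>v)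
  qed
  \<comment> \<open>The extension of \<open>s\<close> prescribed rotations to all indices: write j
    as \<open>s * (j div s) + j mod s\<close> and transport the rotation prescribed at
    \<open>j mod s\<close> by the corresponding power of \<sigma>.\<close>
  define c where "c f j = conj_perm (\<sigma> ^^ (s * (j div s))) (f (j mod s))" for f :: "nat \<Rightarrow> 'a \<Rightarrow> 'a" and j
  have c_step: "c f (s + j) = conj_perm g (c f j)" for f j
  proof -
    have "\<sigma> ^^ (s * ((s + j) div s)) = g \<circ> \<sigma> ^^ (s * (j div s))"
      using \<open>s > 0\<close> by (simp add: g_def funpow_add)
    then show ?thesis unfolding c_def g_def using bij by (simp add: conj_perm_comp)
  qed
  \<comment> \<open>Indices name the same vertex iff they agree modulo \<open>m\<close>, so this
    makes \<open>c f\<close> well defined on vertices. Divisibility of \<open>m\<close> by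
    \<open>s\<close> enters here.\<close>
  have c_cong: "c f i = c f j" if "i mod m = j mod m" for f i j
  proof -
    have s_mod: "i mod s = j mod s" using that s by (metis mod_mod_cancel)
    obtain k where k: "m = s * k" using s by auto
    have "s * (i div s) mod m = s * (j div s) mod m"
      using that s_mod unfolding k mod_mult2_eq mult_mod_right[symmetric] by auto
    from cong[OF this] show ?thesis unfolding c_def s_mod by simp
  qed
  have c_rot: "is_rotation (V - {v j}) (c f j)" if "f \<in> B" for f j
  proof -
    let ?p = "\<sigma> ^^ (s * (j div s))"
    have "is_rotation (V - {v (j mod s)}) (f (j mod s))"
      using PiE_mem[OF that[unfolded B_def], of "j mod s"] \<open>s > 0\<close> by simp
    from is_rotation_conj_perm[OF bij this, of "s * (j div s)"]
    have "is_rotation (?p ` (V - {v (j mod s)})) (c f j)" by (simp add: c_def)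
    also have "?p ` (V - {v (j mod s)}) = V - {v j}"
      using permutes_image[OF pV] \<sigma>v[of "s * (j div s)" "j mod s"] permutes_inj[OF pV]
      by (simp add: image_set_diff)
    finally show ?thesis .
  qed
  have bij_betw: "bij_betw (\<lambda>\<rho>. \<lambda>i\<in>{..<s}. \<rho> (v i)) ?A B"
  proof (rule bij_betwI')
    fix \<rho> \<rho>' assume \<rho>: "\<rho> \<in> ?A" and \<rho>': "\<rho>' \<in> ?A"
    show "((\<lambda>i\<in>{..<s}. \<rho> (v i)) = (\<lambda>i\<in>{..<s}. \<rho>' (v i))) \<longleftrightarrow> \<rho> = \<rho>'"
    proof
      assume eq: "(\<lambda>i\<in>{..<s}. \<rho> (v i)) = (\<lambda>i\<in>{..<s}. \<rho>' (v i))"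
      \<comment> \<open>Injectivity: invariance leads from index j back to \<open>j - s\<close>,
        until one of the first \<open>s\<close> indices is reached.\<close>
      have "\<rho> (v j) = \<rho>' (v j)" for j
      proof (induction j rule: less_induct)
        case (less j)
        show ?case
        proof (cases "j < s")
          case True
          then show ?thesis using fun_cong[OF eq, of j] by simp
        next
          case False
          then obtain i where "j = s + i" by (metis le_Suc_ex not_less)
          then show ?thesis using less[of i] \<open>s > 0\<close> \<rho> \<rho>' inv_iff[of \<rho>] inv_iff[of \<rho>'] by simp
        qed
      qed
      then have "\<rho> u = \<rho>' u" if "u \<in> V" for u
        using that v_ex[of u] \<rho> \<rho>' by (cases "u = r") auto
      then show "\<rho> = \<rho>'"
        using \<rho> \<rho>' by (auto simp: rotation_systems_eq intro: PiE_ext)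
    qed simp
  next
    fix \<rho> assume "\<rho> \<in> ?A"
    then have "is_rotation (V - {v i}) (\<rho> (v i))" for i
      using vV(1)[of i] by (auto simp: rotation_systems_eq PiE_def Pi_def)
    then show "(\<lambda>i\<in>{..<s}. \<rho> (v i)) \<in> B" by (auto simp: B_def)
  next
    fix f assume f: "f \<in> B"
    \<comment> \<open>Surjectivity: any index of the vertex may be chosen, by
      \<open>c_cong\<close>.\<close>
    define idx where "idx u = (SOME j. u = v j)" for u
    define \<rho> where "\<rho> = (\<lambda>u\<in>V. if u = r then \<sigma> else c f (idx u))"
    have \<rho>v: "\<rho> (v j) = c f j" for j
    proof -
      have "v j = v (idx (v j))" unfolding idx_def by (rule someI[of _ j]) simp
      then have "c f (idx (v j)) = c f j" by (intro c_cong) (simp add: v_eq)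
      then show ?thesis using vV[of j] by (simp add: \<rho>_def)
    qed
    have \<rho>r: "\<rho> r = \<sigma>" using root_in by (simp add: \<rho>_def)
    have "is_rotation (V - {u}) (\<rho> u)" if u: "u \<in> V" for u
    proof (cases "u = r")
      case False
      then obtain j where "u = v j" using v_ex[of u] u by blast
      then show ?thesis using c_rot[OF f] \<rho>v by simp
    qed (use rot \<rho>r in simp)
    then have R: "\<rho> \<in> R" unfolding rotation_systems_eq by (auto simp: \<rho>_def)
    have "\<rho> \<in> ?A" using R \<rho>r inv_iff[OF R \<rho>r] by (simp add: \<rho>v c_step)
    moreover have "f = (\<lambda>i\<in>{..<s}. \<rho> (v i))"
    proof (rule PiE_ext)
      show "f \<in> (\<Pi>\<^sub>E i\<in>{..<s}. {\<pi>. is_rotation (V - {v i}) \<pi>})" using f by (simp add: B_def)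
      fix i assume "i \<in> {..<s}"
      then show "f i = (\<lambda>i\<in>{..<s}. \<rho> (v i)) i" by (simp add: \<rho>v c_def)
    qed (use f in \<open>auto simp: \<rho>v c_rot\<close>)
    ultimately show "\<exists>\<rho>\<in>?A. f = (\<lambda>i\<in>{..<s}. \<rho> (v i))" by blast
  qed
  have "card {\<pi>. is_rotation (V - {v i}) \<pi>} = fact (m - 1)" for i
  proof -
    \<comment> \<open>The root witnesses that this neighborhood is nonempty, as
      \<open>card_rotations\<close> demands; it has \<open>m\<close> elements.\<close>
    have "r \<in> V - {v i}" using root_in vV(2)[of i] by auto
    then show ?thesis
      using card_rotations[of "V - {v i}"] finite_V vV(1)[of i] root_in by (auto simp: card_Diff_singleton)
  qed
  then have "card B = fact (m - 1) ^ s" by (simp add: B_def card_PiE)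
  then show ?thesis using bij_betw_same_card[OF bij_betw] by simp
qed

section \<open>Counting maps and their orbits\<close>

text \<open>Sorting by the exact order e of the stabilizer, the maps with e a multiple of k are
  those invariant under the power \<open>m div k\<close> of \<sigma>, which
  \<open>card_invariant_maps\<close> counts. Moebius inversion isolates
  \<open>e = d\<close>.\<close>

lemma card_maps_with_root_rotation:
  assumes rot: "is_rotation N \<sigma>" and d: "d dvd m"
  shows "int (card {\<rho> \<in> R. \<rho> r = \<sigma> \<and> card (stab \<rho>) = d}) =
    (\<Sum>k | d dvd k \<and> k dvd m. moebius_mu (k div d) * fact (m - 1) ^ (m div k))"
proof -
  define A where "A e = card {\<rho> \<in> R. \<rho> r = \<sigma> \<and> card (stab \<rho>) = e}" for e
  have F: "(\<Sum>e | k dvd e \<and> e dvd m. A e) = fact (m - 1) ^ (m div k)" if k: "k dvd m" for k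
  proof -
    have finI: "finite {e. k dvd e \<and> e dvd m}"
      using m_pos by (intro finite_subset[OF _ finite_divisors_nat[of m]]) auto
    have "{\<rho> \<in> R. \<rho> r = \<sigma> \<and> \<sigma> ^^ (m div k) \<in> stab \<rho>} = {\<rho> \<in> R. \<rho> r = \<sigma> \<and> k dvd card (stab \<rho>)}"
      using dvd_card_stab_iff[OF _ k] by auto
    also have "\<dots> = (\<Union>e\<in>{e. k dvd e \<and> e dvd m}. {\<rho> \<in> R. \<rho> r = \<sigma> \<and> card (stab \<rho>) = e})"
      using card_stab_dvd by auto
    finally have "fact (m - 1) ^ (m div k) = card (\<Union>e\<in>{e. k dvd e \<and> e dvd m}. {\<rho> \<in> R. \<rho> r = \<sigma> \<and> card (stab \<rho>) = e})"
      using card_invariant_maps[OF rot, of "m div k"] k by (metis dvd_mult_div_cancel dvd_triv_right)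
    also have "\<dots> = (\<Sum>e | k dvd e \<and> e dvd m. A e)"
      unfolding A_def using finI finite_R by (intro card_UN_disjoint) auto
    finally show ?thesis ..
  qed
  have F_int: "(\<Sum>e | k dvd e \<and> e dvd m. int (A e)) = fact (m - 1) ^ (m div k)" if "k dvd m" for k
    using arg_cong[OF F[OF that], of int] by simp
  have "int (A d) = (\<Sum>k | d dvd k \<and> k dvd m. of_int (moebius_mu (k div d)) * (\<Sum>e | k dvd e \<and> e dvd m. int (A e)))"
    by (rule moebius_inversion_multiples[OF m_pos d, symmetric])
  also have "\<dots> = (\<Sum>k | d dvd k \<and> k dvd m. moebius_mu (k div d) * fact (m - 1) ^ (m div k))"
    by (intro sum.cong) (simp_all add: F_int)
  finally show ?thesis by (simp add: A_def)
qed

text \<open>The count for a fixed root rotation is the same for each of the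
  \<open>fact (m - 1)\<close> possible ones.\<close>

lemma card_maps_with_stab_card:
  assumes d: "d dvd m"
  shows "int (card {\<rho> \<in> R. card (stab \<rho>) = d}) =
    fact (m - 1) * (\<Sum>k | d dvd k \<and> k dvd m. moebius_mu (k div d) * fact (m - 1) ^ (m div k))"
proof -
  have "{\<rho> \<in> R. card (stab \<rho>) = d} =
      (\<Union>\<sigma>\<in>{\<sigma>. is_rotation N \<sigma>}. {\<rho> \<in> R. \<rho> r = \<sigma> \<and> card (stab \<rho>) = d})"
    using root_rotation by auto
  then have "card {\<rho> \<in> R. card (stab \<rho>) = d} =
      (\<Sum>\<sigma> | is_rotation N \<sigma>. card {\<rho> \<in> R. \<rho> r = \<sigma> \<and> card (stab \<rho>) = d})"
    using finite_R finite_rotations[OF finite_N] by (simp only:) (intro card_UN_disjoint, auto)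
  then show ?thesis
    by (simp add: card_maps_with_root_rotation[OF _ d] card_rotations[OF finite_N ne])
qed

text \<open>Counting orbits produces a factor \<open>fact m\<close> on the left. Cancelling the
  \<open>fact (m - 1)\<close> choices of the root rotation leaves \<open>m\<close>, the denominator
  of the final formula.\<close>

theorem symmetric_imbedding_count_eq:
  assumes d: "d dvd m"
  shows "int (symmetric_imbedding_count V r d) * int m =
    int d * (\<Sum>k | d dvd k \<and> k dvd m. moebius_mu (k div d) * fact (m - 1) ^ (m div k))"
proof -
  let ?O = "unlabeled_imbeddings V (complete_edges V) r"
  let ?\<Sigma> = "\<Sum>k | d dvd k \<and> k dvd m. moebius_mu (k div d) * fact (m - 1) ^ (m div k)"
  interpret group_action G R "map_action V (complete_edges V)" by (rule group_action_map_action)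
  have "X \<subseteq> R" if "X \<in> ?O" for X
    using that orbits_coverture unfolding unlabeled_imbeddings_def by blast
  then have "{X \<in> ?O. \<forall>\<rho>\<in>X. d_fold_symmetric V (complete_edges V) r d \<rho>} =
      {X \<in> ?O. \<forall>\<rho>\<in>X. card (stab \<rho>) = d}"
    using d_fold_symmetric_iff by blast
  then have "symmetric_imbedding_count V r d * order G = d * card {\<rho> \<in> R. card (stab \<rho>) = d}"
    using card_orbits_stabilizer_card[OF finite_R, of d]
    by (simp only: symmetric_imbedding_count_def unlabeled_imbeddings_def map_aut_group_def)
  from arg_cong[OF this, of int]
  have "int (symmetric_imbedding_count V r d) * fact m = int d * int (card {\<rho> \<in> R. card (stab \<rho>) = d})"
    by (simp only: order_G of_nat_mult of_nat_fact)
  then have "int (symmetric_imbedding_count V r d) * fact m = int d * (fact (m - 1) * ?\<Sigma>)"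
    unfolding card_maps_with_stab_card[OF d] .
  moreover have "(fact m :: int) = int m * fact (m - 1)"
    using m_pos by (rule fact_reduce)
  ultimately have "fact (m - 1) * (int (symmetric_imbedding_count V r d) * int m) = fact (m - 1) * (int d * ?\<Sigma>)"
    by (simp only: mult_ac)
  then show ?thesis by simp
qed

end

theorem theorem15:
  fixes V :: "'a set" and r :: 'a and n d :: nat
  assumes "n \<ge> 2" and "finite V" and "card V = n" and "r \<in> V" and "d dvd n - 1"
  shows "real (symmetric_imbedding_count V r d) =
    real d * (\<Sum>k | d dvd k \<and> k dvd n - 1.
      real_of_int (moebius_mu (k div d)) * (fact (n - 2) ^ ((n - 1) div k) / real (n - 1)))"
proof -
  have m: "card (V - {r}) = n - 1" "n - 1 - 1 = n - 2" using assms by simp_all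
  then have "V - {r} \<noteq> {}" using assms(1) by (metis One_nat_def card.empty diff_is_0_eq not_less_eq_eq numeral_2_eq_2)
  then interpret rooted_complete_graph V r using assms by unfold_locales
  \<comment> \<open>The identity is kept multiplied by \<open>n - 1\<close> over the integers; the
    division takes place only in the reals, where single summands need not be integral.\<close>
  have "real_of_int (int (symmetric_imbedding_count V r d) * int (n - 1)) =
      real_of_int (int d * (\<Sum>k | d dvd k \<and> k dvd n - 1. moebius_mu (k div d) * fact (n - 2) ^ ((n - 1) div k)))"
    using symmetric_imbedding_count_eq[of d] assms(5) unfolding m by simp
  then have "real (symmetric_imbedding_count V r d) * real (n - 1) =
      real d * (\<Sum>k | d dvd k \<and> k dvd n - 1. real_of_int (moebius_mu (k div d)) * fact (n - 2) ^ ((n - 1) div k))"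
    by (simp only: of_int_mult of_int_of_nat_eq of_int_sum of_int_power of_int_fact)
  then have "real (symmetric_imbedding_count V r d) =
      real d * ((\<Sum>k | d dvd k \<and> k dvd n - 1. real_of_int (moebius_mu (k div d)) * fact (n - 2) ^ ((n - 1) div k)) / real (n - 1))"
    using assms(1) by (simp add: nonzero_eq_divide_eq)
  then show ?thesis by (simp add: sum_divide_distrib)
qed

end
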